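(* Let $k\geq 1$ be an integer. If $G$ is a nontrivial connected graph with $\Delta(G)\ge 3$, then $i_{[kR]}(G)\ge \dfrac{|V(G)|(k+1)}{\Delta(G)+1}$.
   Context: All graphs are finite and simple; nontrivial means at least two vertices; $\Delta(G)$ is the maximum degree. For $f\colon V(G)\to\mathbb{Z}_{\ge 0}$ and $S\subseteq V(G)$, $f(S)=\sum_{v\in S}f(v)$, and $AN(v)=\{w\in N(v): f(w)\ge 1\}$. A $[k]$-Roman dominating function of $G$ is a function $f\colon V(G)\to\{0,1,\ldots,k+1\}$ such that $f(N[v])\ge k+|AN(v)|$ for every vertex $v$ with $f(v)<k$; its weight is $f(V(G))$. $i_{[kR]}(G)$ is the minimum weight of such a function whose set of vertices with positive label is independent. *)

theory Defs
  imports Complex_Main "Graph_Theory.Graph_Theory"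
begin

text \<open>
  A finite simple graph is a \<^locale>\<open>graph\<close> of the AFP entry Graph_Theory: a finite symmetric
  digraph without loops and parallel arcs, in which an edge is a pair of opposite arcs.
\<close>

definition nbhd :: "('a, 'b) pre_digraph \<Rightarrow> 'a \<Rightarrow> 'a set" where
  "nbhd G v = {w. v \<rightarrow>\<^bsub>G\<^esub> w}"

definition closed_nbhd :: "('a, 'b) pre_digraph \<Rightarrow> 'a \<Rightarrow> 'a set" where
  "closed_nbhd G v = insert v (nbhd G v)"

text \<open>
  In a symmetric digraph without parallel arcs the out-degree of a vertex is the degree of that
  vertex in the undirected graph.
\<close>

definition max_degree :: "('a, 'b) pre_digraph \<Rightarrow> nat" where
  "max_degree G = Max (out_degree G ` verts G)"

definition independent_set :: "('a, 'b) pre_digraph \<Rightarrow> 'a set \<Rightarrow> bool" where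
  "independent_set G S \<longleftrightarrow> S \<subseteq> verts G \<and> (\<forall>u\<in>S. \<forall>v\<in>S. \<not> u \<rightarrow>\<^bsub>G\<^esub> v)"

definition active_nbhd :: "('a, 'b) pre_digraph \<Rightarrow> ('a \<Rightarrow> nat) \<Rightarrow> 'a \<Rightarrow> 'a set" where
  "active_nbhd G f v = {w \<in> nbhd G v. f w \<ge> 1}"

text \<open>
  A labelling of the vertices is a total function on the vertex type; its values outside
  \<^term>\<open>verts G\<close> are irrelevant.
\<close>

definition kRoman_dominating :: "nat \<Rightarrow> ('a, 'b) pre_digraph \<Rightarrow> ('a \<Rightarrow> nat) \<Rightarrow> bool" where
  "kRoman_dominating k G f \<longleftrightarrow>
     (\<forall>v\<in>verts G. f v \<le> k + 1) \<and>
     (\<forall>v\<in>verts G. f v < k \<longrightarrow> sum f (closed_nbhd G v) \<ge> k + card (active_nbhd G f v))"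

definition independent_kRoman_dominating ::
    "nat \<Rightarrow> ('a, 'b) pre_digraph \<Rightarrow> ('a \<Rightarrow> nat) \<Rightarrow> bool" where
  "independent_kRoman_dominating k G f \<longleftrightarrow>
     kRoman_dominating k G f \<and> independent_set G {v \<in> verts G. f v > 0}"

definition weight :: "('a, 'b) pre_digraph \<Rightarrow> ('a \<Rightarrow> nat) \<Rightarrow> nat" where
  "weight G f = sum f (verts G)"

definition independent_kRoman_number :: "nat \<Rightarrow> ('a, 'b) pre_digraph \<Rightarrow> nat" where
  "independent_kRoman_number k G =
     (LEAST w. \<exists>f. independent_kRoman_dominating k G f \<and> weight G f = w)"

text \<open>
  The minimum is attained: label a maximal independent set with \<open>k + 1\<close>.
\<close>

lemma independent_kRoman_dominating_exists:
  assumes G: "Digraph.graph G"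
  shows "\<exists>f. independent_kRoman_dominating k G f"
proof -
  interpret Digraph.graph G by (rule G)
  have fin: "finite {S. independent_set G S}"
    by (rule finite_subset[of _ "Pow (verts G)"]) (auto simp: independent_set_def)
  have ne: "{} \<in> {S. independent_set G S}"
    by (simp add: independent_set_def)
  obtain S where S: "independent_set G S"
    and max: "\<And>T. independent_set G T \<Longrightarrow> S \<subseteq> T \<Longrightarrow> T = S"
    using finite_has_maximal[OF fin] ne by (metis empty_iff mem_Collect_eq)
  define f where "f = (\<lambda>v. if v \<in> S then k + 1 else 0)"
  have finN: "finite (nbhd G v)" for v
    by (rule finite_subset[of _ "verts G"]) (auto simp: nbhd_def adj_in_verts)
  have "sum f (closed_nbhd G v) \<ge> k + card (active_nbhd G f v)"
    if v: "v \<in> verts G" and lt: "f v < k" for v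
  proof -
    have vS: "v \<notin> S" using lt by (auto simp: f_def split: if_splits)
    have "\<not> independent_set G (insert v S)" using max vS by blast
    then obtain u where u: "u \<in> S" "v \<rightarrow>\<^bsub>G\<^esub> u"
      using S v arcs_ends_symmetric[OF sym_arcs] adj_not_same
      unfolding independent_set_def by blast
    have A: "active_nbhd G f v = nbhd G v \<inter> S"
      by (auto simp: active_nbhd_def f_def)
    have "u \<in> nbhd G v \<inter> S" using u by (simp add: nbhd_def)
    then have c: "card (nbhd G v \<inter> S) \<ge> 1"
      using finN by (metis One_nat_def Suc_leI card_gt_0_iff empty_iff finite_Int)
    have "card (nbhd G v \<inter> S) * (k + 1) = (\<Sum>w\<in>nbhd G v \<inter> S. k + 1)"
      by simp
    also have "\<dots> \<le> sum f (closed_nbhd G v)"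
      unfolding f_def closed_nbhd_def
      by (rule order_trans[OF _ sum_mono2[of _ "nbhd G v \<inter> S"]]) (use finN in auto)
    finally have le: "card (nbhd G v \<inter> S) * (k + 1) \<le> sum f (closed_nbhd G v)" .
    have "k + card (nbhd G v \<inter> S) \<le> card (nbhd G v \<inter> S) * (k + 1)"
      using c by (cases "card (nbhd G v \<inter> S)") auto
    also note le
    finally show ?thesis by (simp only: A)
  qed
  moreover have "{v \<in> verts G. f v > 0} = S"
    using S by (auto simp: f_def independent_set_def)
  ultimately have "independent_kRoman_dominating k G f"
    using S by (auto simp: independent_kRoman_dominating_def kRoman_dominating_def f_def)
  then show ?thesis by blast
qed

lemma independent_kRoman_number_attained:
  assumes "Digraph.graph G"
  shows "\<exists>f. independent_kRoman_dominating k G f \<and> weight G f = independent_kRoman_number k G"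
  unfolding independent_kRoman_number_def
  by (rule LeastI_ex) (use independent_kRoman_dominating_exists[OF assms] in blast)

end

theory Submission
  imports Defs
begin

text \<open>
  Discharging: independence forces every positive label to be \<open>k\<close> or \<open>k + 1\<close>, so a vertex of
  label 0 has a neighbour of label \<open>k + 1\<close> or at least two neighbours of label \<open>k\<close>, the latter
  only if \<open>k \<ge> 2\<close>. With \<open>\<Delta>\<close> the maximum degree, a vertex \<open>w\<close> of positive label keeps \<open>k + 1\<close> of
  the \<open>f w * (\<Delta> + 1)\<close> units it owns and divides the remaining \<open>surplus\<close> into \<open>\<Delta>\<close> equal shares,
  one for each neighbour. A vertex of label 0 then receives at least \<open>k + 1\<close> units; in the case
  of two neighbours of label \<open>k\<close> this is \<open>2 * (k * \<Delta> - 1) \<ge> (k + 1) * \<Delta>\<close>.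
\<close>

context
  fixes G :: "('a, 'b) pre_digraph"
  assumes graph: "Digraph.graph G"
begin

interpretation Digraph.graph G
  by (rule graph)

lemma nbhd_subset_verts: "nbhd G v \<subseteq> verts G"
  by (auto simp: nbhd_def adj_in_verts)

lemma finite_nbhd: "finite (nbhd G v)"
  using nbhd_subset_verts finite_verts by (rule finite_subset)

lemma nbhd_sym: "w \<in> nbhd G v \<longleftrightarrow> v \<in> nbhd G w"
  unfolding nbhd_def using arcs_ends_symmetric[OF sym_arcs] by blast

lemma card_nbhd_le_max_degree:
  assumes "v \<in> verts G"
  shows "card (nbhd G v) \<le> max_degree G"
proof -
  have "nbhd G v \<subseteq> head G ` out_arcs G v"
    by (auto simp: nbhd_def arcs_ends_def arc_to_ends_def)
  then have "card (nbhd G v) \<le> out_degree G v"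
    unfolding out_degree_def by (rule surj_card_le[OF finite_out_arcs])
  also have "\<dots> \<le> max_degree G"
    using assms by (auto simp: max_degree_def)
  finally show ?thesis .
qed

lemma sum_closed_nbhd:
  "sum f (closed_nbhd G v) = f v + sum f (active_nbhd G f v)"
proof -
  have "v \<notin> nbhd G v"
    using adj_not_same by (auto simp: nbhd_def)
  moreover have "sum f (nbhd G v) = sum f (active_nbhd G f v)"
    by (rule sum.mono_neutral_right) (auto simp: active_nbhd_def finite_nbhd)
  ultimately show ?thesis
    by (simp add: closed_nbhd_def finite_nbhd)
qed

text \<open>By independence a vertex of positive label has no active neighbour, so its closed
  neighbourhood carries only \<open>f v\<close>. A label below \<open>k\<close> would then violate
  the domination condition.\<close>

lemma independent_kRoman_dominating_label:
  assumes f: "independent_kRoman_dominating k G f" and v: "v \<in> verts G" and pos: "f v > 0"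
  shows "f v = k \<or> f v = k + 1"
proof -
  have "active_nbhd G f v = {}"
    using f v pos nbhd_subset_verts[of v]
    unfolding independent_kRoman_dominating_def independent_set_def active_nbhd_def nbhd_def
    by fastforce
  then have "\<not> f v < k"
    using f v sum_closed_nbhd[of f v]
    by (auto simp: independent_kRoman_dominating_def kRoman_dominating_def)
  moreover have "f v \<le> k + 1"
    using f v by (auto simp: independent_kRoman_dominating_def kRoman_dominating_def)
  ultimately show ?thesis by linarith
qed

text \<open>The shares are left undivided, so all counts stay in the naturals and carry an extra
  factor \<open>max_degree G\<close>. Truncated subtraction gives label 0 the surplus 0.\<close>

definition surplus :: "nat \<Rightarrow> ('a \<Rightarrow> nat) \<Rightarrow> 'a \<Rightarrow> nat" where
  "surplus k f w = f w * (max_degree G + 1) - (k + 1)"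

lemma surplus_received:
  assumes f: "independent_kRoman_dominating k G f" and k: "k \<ge> 1" and D: "max_degree G \<ge> 3"
    and v: "v \<in> verts G" and zero: "f v = 0"
  shows "(k + 1) * max_degree G \<le> sum (surplus k f) (nbhd G v)"
proof -
  let ?A = "active_nbhd G f v" and ?D = "max_degree G"
  have sub: "?A \<subseteq> nbhd G v" and fin: "finite ?A"
    using finite_nbhd[of v] by (auto simp: active_nbhd_def)
  have le: "sum (surplus k f) ?A \<le> sum (surplus k f) (nbhd G v)"
    using sub by (intro sum_mono2) (auto simp: finite_nbhd)
  have dom: "k + card ?A \<le> sum f ?A"
    using f v zero k sum_closed_nbhd[of f v]
    by (auto simp: independent_kRoman_dominating_def kRoman_dominating_def)
  show ?thesis
  proof (cases "\<exists>w\<in>?A. f w = k + 1")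
    case True
    then obtain w where w: "w \<in> ?A" "f w = k + 1" by blast
    have "(k + 1) * ?D = surplus k f w"
      by (simp add: surplus_def w)
    also have "\<dots> \<le> sum (surplus k f) ?A"
      using w fin by (intro member_le_sum) auto
    finally show ?thesis using le by linarith
  next
    case False
    have lab: "f w = k" if "w \<in> ?A" for w
      using that False independent_kRoman_dominating_label[OF f, of w] sub nbhd_subset_verts[of v]
      by (auto simp: active_nbhd_def)
    have "k + card ?A \<le> card ?A * k"
      using dom lab by simp
    \<comment> \<open>With \<open>c = card ?A\<close>, the inequality k + c \<le> c * k says (c - 1)
      * (k - 1) \<ge> 1 over the integers.\<close>
    then have c: "card ?A \<ge> 2" and k2: "k \<ge> 2"
      using k by (cases "card ?A"; cases "card ?A - 1"; cases "k - 1"; auto)+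
    \<comment> \<open>This substitution resolves the truncated subtraction; what remains to be shown
      is 2 \<le> (m + 1) * \<open>?D\<close>.\<close>
    obtain m where m: "k = m + 2"
      using k2 by (metis add.commute le_Suc_ex)
    have "3 \<le> m * ?D + ?D"
      using D by simp
    then have "(k + 1) * ?D \<le> 2 * (k * (?D + 1) - (k + 1))"
      by (simp add: m algebra_simps)
    also have "\<dots> \<le> card ?A * (k * (?D + 1) - (k + 1))"
      using c by (rule mult_le_mono1)
    also have "\<dots> = sum (surplus k f) ?A"
      using lab by (simp add: surplus_def)
    finally show ?thesis using le by linarith
  qed
qed

lemma independent_kRoman_weight_bound:
  assumes f: "independent_kRoman_dominating k G f" and k: "k \<ge> 1" and D: "max_degree G \<ge> 3"
  shows "card (verts G) * (k + 1) \<le> weight G f * (max_degree G + 1)"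
proof -
  let ?D = "max_degree G" and ?g = "surplus k f"
  define Z where "Z = {v \<in> verts G. f v = 0}"
  define P where "P = {v \<in> verts G. f v > 0}"
  have fin: "finite Z" "finite P" and V: "verts G = Z \<union> P" and dis: "Z \<inter> P = {}"
    using finite_verts by (auto simp: Z_def P_def)
  have g0: "?g w = 0" if "w \<in> Z" for w
    using that by (simp add: Z_def surplus_def)
  have gP: "?g w + (k + 1) = f w * (?D + 1)" if "w \<in> P" for w
  proof -
    have "f w = k \<or> f w = k + 1"
      using that independent_kRoman_dominating_label[OF f] by (auto simp: P_def)
    \<comment> \<open>Hence the subtraction in \<open>surplus\<close> is exact also for label
      \<open>k\<close>.\<close>
    moreover have "k + 1 \<le> k * (?D + 1)"
      using k D mult_le_mono[OF k D] by simp
    ultimately show ?thesis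
      by (auto simp: surplus_def)
  qed
  have "card Z * (k + 1) * ?D = (\<Sum>v\<in>Z. (k + 1) * ?D)"
    by (simp only: sum_constant of_nat_id mult.assoc)
  also have "\<dots> \<le> (\<Sum>v\<in>Z. sum ?g (nbhd G v))"
    using surplus_received[OF f k D] by (intro sum_mono) (auto simp: Z_def)
  \<comment> \<open>Summing over all vertices prepares the double count: after the swap, symmetry of
    adjacency makes each \<open>?g w\<close> occur once per neighbour of \<open>w\<close>.\<close>
  also have "\<dots> \<le> (\<Sum>v\<in>verts G. sum ?g (nbhd G v))"
    by (intro sum_mono2) (auto simp: Z_def)
  also have "\<dots> = (\<Sum>v\<in>verts G. \<Sum>w | w \<in> verts G \<and> w \<in> nbhd G v. ?g w)"
    using nbhd_subset_verts by (intro sum.cong) auto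
  also have "\<dots> = (\<Sum>w\<in>verts G. \<Sum>v | v \<in> verts G \<and> w \<in> nbhd G v. ?g w)"
    by (rule sum.swap_restrict) auto
  also have "\<dots> = (\<Sum>w\<in>verts G. card (nbhd G w) * ?g w)"
  proof (intro sum.cong refl)
    fix w
    have "{v \<in> verts G. w \<in> nbhd G v} = nbhd G w"
      using nbhd_sym nbhd_subset_verts by blast
    then show "(\<Sum>v | v \<in> verts G \<and> w \<in> nbhd G v. ?g w) = card (nbhd G w) * ?g w"
      by simp
  qed
  also have "\<dots> \<le> (\<Sum>w\<in>verts G. ?D * ?g w)"
    using card_nbhd_le_max_degree by (intro sum_mono mult_le_mono1)
  also have "\<dots> = sum ?g P * ?D"
    using g0 fin dis by (simp add: V sum.union_disjoint sum_distrib_left mult.commute)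
  \<comment> \<open>The common factor \<open>?D\<close> > 0 cancels.\<close>
  finally have "card Z * (k + 1) \<le> sum ?g P"
    using D by simp
  then have "card (verts G) * (k + 1) \<le> sum ?g P + card P * (k + 1)"
    using fin dis by (simp add: V card_Un_disjoint algebra_simps)
  also have "\<dots> = (\<Sum>w\<in>P. ?g w + (k + 1))"
    by (simp only: sum.distrib sum_constant of_nat_id distrib_left)
  also have "\<dots> = (\<Sum>w\<in>P. f w * (?D + 1))"
    using gP by (rule sum.cong[OF refl])
  also have "\<dots> = weight G f * (?D + 1)"
  proof -
    have "sum f Z = 0" by (simp add: Z_def)
    then have "weight G f = sum f P"
      using fin dis by (simp add: weight_def V sum.union_disjoint)
    then show ?thesis by (simp only: sum_distrib_right)
  qed
  finally show ?thesis .
qed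

end

theorem theorem3p6:
  fixes G :: "('a, 'b) pre_digraph" and k :: nat
  assumes "k \<ge> 1"
    and "Digraph.graph G"
    and "card (verts G) \<ge> 2"
    and "Digraph_Component.connected G"
    and "max_degree G \<ge> 3"
  shows "real (independent_kRoman_number k G)
           \<ge> real (card (verts G)) * (real k + 1) / (real (max_degree G) + 1)"
proof -
  obtain f where f: "independent_kRoman_dominating k G f"
    and w: "weight G f = independent_kRoman_number k G"
    using independent_kRoman_number_attained[OF assms(2)] by blast
  have "real (card (verts G) * (k + 1)) \<le> real (independent_kRoman_number k G * (max_degree G + 1))"
    using independent_kRoman_weight_bound[OF assms(2) f assms(1,5)] w by (metis of_nat_le_iff)
  then show ?thesis
    by (simp add: divide_le_eq algebra_simps)
qed

end
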